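(* Let $[a,b]$ be a real interval and let $\varphi\in C^1[a,b]$ be a monotonic function. For $\alpha,\beta\in\mathbb{C}$ with $\operatorname{Re}(\alpha)>0$, $\operatorname{Re}(\beta)>0$, let $\mathcal{A}(x)=\sum_{n=0}^\infty a_nx^n$ be analytic on a complex disc $\mathcal{D}(0,R)$ with $R>(b-a)^{\operatorname{Re}(\beta)}$, where the coefficients $a_n=a_n(\alpha,\beta)$ may depend on $\alpha,\beta$. Then the set $$\left\{{}^{\mathcal{A}}_{a}I^{\alpha,\beta}_{\varphi(x)}\;:\;\alpha,\beta\in\mathbb{C},\ \operatorname{Re}(\alpha)>0,\ \operatorname{Re}(\beta)>0\right\}$$ is a commutative family of operators; that is, for all $\alpha,\beta,\gamma,\delta\in\mathbb{C}$ with positive real part (and $u\in L^1_\varphi[a,b]$), $${}^{\mathcal{A}}_{a}I^{\alpha,\beta}_{\varphi(x)}\circ{}^{\mathcal{A}}_{a}I^{\gamma,\delta}_{\varphi(x)}u(x)={}^{\mathcal{A}}_{a}I^{\gamma,\delta}_{\varphi(x)}\circ{}^{\mathcal{A}}_{a}I^{\alpha,\beta}_{\varphi(x)}u(x).$$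
   Context: $L^1_\varphi[a,b]$ is the space of Lebesgue measurable $u:[a,b]\to\mathbb{C}$ with $\int_a^b|u(x)|\varphi'(x)\,dx<\infty$. The generalised fractional integral of $u$ with analytic kernel $\mathcal{A}$ with respect to $\varphi$ is $${}^{\mathcal{A}}_{a}I^{\alpha,\beta}_{\varphi(x)}u(x)=\int_a^x\varphi'(t)\,[\varphi(x)-\varphi(t)]^{\alpha-1}\,\mathcal{A}\big([\varphi(x)-\varphi(t)]^{\beta}\big)\,u(t)\,dt ,$$ where $\mathcal{A}$ is taken with the coefficients belonging to the parameters of the operator.
   Formalization: Since R > (b-a)^{Re β} does not make the operators defined for general φ, it is also assumed that [φ(x)-φ(t)]^β lies in D(0,R) for a ≤ t ≤ x ≤ b; R may depend on α, β; equality holds almost everywhere with respect to |φ'(x)|dx, i.e. in L^1_φ, not at every x. *)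

theory Defs
  imports "HOL-Complex_Analysis.Complex_Analysis"
begin

text \<open>In all definitions, \<open>\<phi>'\<close> stands for the derivative of \<open>\<phi>\<close> on \<open>[a,b]\<close>, one-sided at
  the end points.\<close>

text \<open>The condition is finiteness of the integral of \<open>\<bar>u\<bar> \<bar>\<phi>'\<bar>\<close>, also when \<open>\<phi>\<close> is decreasing:
  Lebesgue integrability of a real function is integrability of its absolute value.\<close>

definition L1_phi :: "real \<Rightarrow> real \<Rightarrow> (real \<Rightarrow> real) \<Rightarrow> (real \<Rightarrow> complex) set" where
  "L1_phi a b \<phi>' = {u. u \<in> borel_measurable (lebesgue_on {a..b}) \<and>
                       integrable (lebesgue_on {a..b}) (\<lambda>x. norm (u x) * \<phi>' x)}"

text \<open>The measure \<open>\<bar>\<phi>'(x)\<bar> dx\<close> on \<open>[a,b]\<close>.  Two functions are the same element of the space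
  above iff they agree almost everywhere with respect to it; this is coarser than agreement
  Lebesgue-almost everywhere if \<open>\<phi>'\<close> vanishes on a set of positive measure.\<close>

definition phi_measure :: "real \<Rightarrow> real \<Rightarrow> (real \<Rightarrow> real) \<Rightarrow> real measure" where
  "phi_measure a b \<phi>' = density (lebesgue_on {a..b}) (\<lambda>x. ennreal \<bar>\<phi>' x\<bar>)"

text \<open>\<open>A \<alpha> \<beta>\<close> is the analytic kernel whose coefficients belong to the parameters \<open>\<alpha>, \<beta>\<close>.
  Powers are principal values, which matters only for decreasing \<open>\<phi>\<close>.\<close>

definition frac_int ::
  "real \<Rightarrow> (real \<Rightarrow> real) \<Rightarrow> (real \<Rightarrow> real) \<Rightarrow> (complex \<Rightarrow> complex \<Rightarrow> complex \<Rightarrow> complex) \<Rightarrow>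
   complex \<Rightarrow> complex \<Rightarrow> (real \<Rightarrow> complex) \<Rightarrow> real \<Rightarrow> complex" where
  "frac_int a \<phi> \<phi>' A \<alpha> \<beta> u x =
     (LINT t:{a..x}|lebesgue.
        complex_of_real (\<phi>' t) * complex_of_real (\<phi> x - \<phi> t) powr (\<alpha> - 1) *
        A \<alpha> \<beta> (complex_of_real (\<phi> x - \<phi> t) powr \<beta>) * u t)"

end

theory Submission
  imports Defs
begin

text \<open>For a monotone \<open>\<phi>\<close> choose the sign \<open>\<sigma>\<close> that makes \<open>\<psi> = \<sigma> \<phi>\<close> increasing.  By the substitution
  rule, \<open>\<psi>\<close> pushes the measure \<open>\<mu> = \<bar>\<phi>'(x)\<bar> dx\<close> forward to Lebesgue measure on \<open>[\<psi>(a), \<psi>(b)]\<close>, and the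
  operators become \<open>u \<mapsto> \<integral> k(\<psi>(x) - \<psi>(t)) u(t) d\<mu>(t)\<close> with an integrable kernel \<open>k\<close> vanishing on
  the nonpositive half-line: \<open>k\<close> is bounded by a constant times \<open>s\<^sup>p\<close> with \<open>p = Re \<alpha> - 1 > -1\<close>.  Tonelli makes the
  double integral in a composition absolutely convergent for \<open>\<mu>\<close>-almost every \<open>x\<close>; there Fubini turns
  it into one integral against the convolution \<open>k * l\<close>, which is symmetric in \<open>k\<close> and \<open>l\<close>.\<close>

section \<open>Volterra operators over a map that carries the measure to Lebesgue measure\<close>

text \<open>Only the image of \<open>M\<close> under \<open>\<psi>\<close> is prescribed.
  Injectivity is not asked for, so \<open>\<phi>\<close> may be constant on subintervals; these
  carry no mass.\<close>

locale uniformizing_map = finite_measure M for M :: "'a measure" +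
  fixes \<psi> :: "'a \<Rightarrow> real" and c d :: real
  assumes measurable_psi [measurable]: "\<psi> \<in> borel_measurable M"
    and psi_range: "x \<in> space M \<Longrightarrow> \<psi> x \<in> {c..d}"
    and distr_psi: "distr M borel \<psi> = density lborel (indicator {c..d})"
begin

text \<open>Integration runs over the whole space. The variable upper limit of a Volterra integral
  is hidden in kernels that vanish at nonpositive arguments.\<close>

definition volterra :: "(real \<Rightarrow> complex) \<Rightarrow> ('a \<Rightarrow> complex) \<Rightarrow> 'a \<Rightarrow> complex" where
  "volterra k u x = (\<integral>t. k (\<psi> x - \<psi> t) * u t \<partial>M)"

lemma borel_measurable_volterra:
  assumes [measurable]: "k \<in> borel_measurable borel" "u \<in> borel_measurable M"
  shows "volterra k u \<in> borel_measurable M"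
  unfolding volterra_def by measurable

lemma nn_integral_psi_le:
  assumes [measurable]: "h \<in> borel_measurable borel"
  shows "(\<integral>\<^sup>+x. h (\<psi> x) \<partial>M) \<le> (\<integral>\<^sup>+w. h w \<partial>lborel)"
proof -
  have "(\<integral>\<^sup>+x. h (\<psi> x) \<partial>M) = (\<integral>\<^sup>+w. h w \<partial>distr M borel \<psi>)"
    by (subst nn_integral_distr) auto
  also have "\<dots> = (\<integral>\<^sup>+w. indicator {c..d} w * h w \<partial>lborel)"
    unfolding distr_psi by (subst nn_integral_density) auto
  also have "\<dots> \<le> (\<integral>\<^sup>+w. h w \<partial>lborel)"
    by (intro nn_integral_mono) (auto simp: indicator_def)
  finally show ?thesis .
qed

text \<open>Enlarging \<open>{c..d}\<close> to the whole line makes translation invariance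
  available. The resulting bound is uniform in \<open>q\<close>, as a Young-type estimate
  requires.\<close>

lemma nn_integral_shift_psi_le:
  assumes [measurable]: "h \<in> borel_measurable borel"
  shows "(\<integral>\<^sup>+x. h (\<psi> x - q) \<partial>M) \<le> (\<integral>\<^sup>+w. h w \<partial>lborel)"
proof -
  have "(\<integral>\<^sup>+x. h (\<psi> x - q) \<partial>M) \<le> (\<integral>\<^sup>+w. h (w - q) \<partial>lborel)"
    by (rule nn_integral_psi_le) measurable
  also have "\<dots> = (\<integral>\<^sup>+w. h w \<partial>lborel)"
    using nn_integral_real_affine[of h 1 "-q"] by simp
  finally show ?thesis .
qed

lemma integral_psi:
  fixes h :: "real \<Rightarrow> complex"
  assumes [measurable]: "h \<in> borel_measurable borel" and "\<And>w. w \<notin> {c..d} \<Longrightarrow> h w = 0"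
  shows "(\<integral>x. h (\<psi> x) \<partial>M) = (\<integral>w. h w \<partial>lborel)"
proof -
  have "(\<integral>x. h (\<psi> x) \<partial>M) = (\<integral>w. h w \<partial>distr M borel \<psi>)"
    by (subst integral_distr) auto
  also have "\<dots> = (\<integral>w. h w \<partial>density lborel (\<lambda>w. ennreal (indicator {c..d} w)))"
    unfolding distr_psi by (simp add: ennreal_indicator)
  also have "\<dots> = (\<integral>w. indicator {c..d} w *\<^sub>R h w \<partial>lborel)"
    by (subst integral_density) auto
  also have "\<dots> = (\<integral>w. h w \<partial>lborel)"
    using assms(2) by (intro Bochner_Integration.integral_cong) (auto simp: indicator_def)
  finally show ?thesis .
qed

text \<open>One-sidedness of the kernels confines the integrand to points between
  \<open>\<psi> s\<close> and \<open>\<psi> x\<close>, hence to \<open>{c..d}\<close>. Both sides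
  are therefore convolution integrals over the whole line, where a reflection exchanges the
  factors.\<close>

lemma convolution_commute:
  fixes k l :: "real \<Rightarrow> complex"
  assumes [measurable]: "k \<in> borel_measurable borel" "l \<in> borel_measurable borel"
    and "\<And>s. s \<le> 0 \<Longrightarrow> k s = 0" "\<And>s. s \<le> 0 \<Longrightarrow> l s = 0"
    and "x \<in> space M" "s \<in> space M"
  shows "(\<integral>t. k (\<psi> x - \<psi> t) * l (\<psi> t - \<psi> s) \<partial>M) = (\<integral>t. l (\<psi> x - \<psi> t) * k (\<psi> t - \<psi> s) \<partial>M)"
proof -
  have eq: "(\<integral>t. k (\<psi> x - \<psi> t) * l (\<psi> t - \<psi> s) \<partial>M) = (\<integral>w. k (\<psi> x - w) * l (w - \<psi> s) \<partial>lborel)"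
    if [measurable]: "k \<in> borel_measurable borel" "l \<in> borel_measurable borel"
      and "\<And>s. s \<le> 0 \<Longrightarrow> k s = 0" "\<And>s. s \<le> 0 \<Longrightarrow> l s = 0" for k l :: "real \<Rightarrow> complex"
  proof (rule integral_psi[where h = "\<lambda>w. k (\<psi> x - w) * l (w - \<psi> s)"])
    fix w assume w: "w \<notin> {c..d}"
    have "\<psi> x - w \<le> 0 \<or> w - \<psi> s \<le> 0"
      using psi_range[OF \<open>x \<in> space M\<close>] psi_range[OF \<open>s \<in> space M\<close>] w by auto
    then show "k (\<psi> x - w) * l (w - \<psi> s) = 0" using that by auto
  qed measurable
  \<comment> \<open>The reflection \<open>w \<mapsto> \<psi> x + \<psi> s - w\<close> exchanges
    \<open>\<psi> x - w\<close> and \<open>w - \<psi> s\<close>.\<close>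
  have "(\<integral>w. k (\<psi> x - w) * l (w - \<psi> s) \<partial>lborel) = (\<integral>w. l (\<psi> x - w) * k (w - \<psi> s) \<partial>lborel)"
    using lborel_integral_real_affine[of "-1" "\<lambda>w. k (\<psi> x - w) * l (w - \<psi> s)" "\<psi> x + \<psi> s"]
    by (simp add: algebra_simps)
  then show ?thesis using assms by (simp add: eq)
qed

text \<open>As in Young's inequality, integrating the norm over \<open>x\<close> as well gives at
  most the product of the three \<open>L^1\<close> norms. An integral that is finite in total is
  finite for almost every \<open>x\<close>.\<close>

lemma AE_integrable_iterated_kernel:
  fixes k l :: "real \<Rightarrow> complex"
  assumes k: "integrable lborel k" and l: "integrable lborel l" and u: "integrable M u"
  shows "AE x in M. integrable (M \<Otimes>\<^sub>M M) (\<lambda>(s, t). k (\<psi> x - \<psi> t) * (l (\<psi> t - \<psi> s) * u s))"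
proof -
  have [measurable]: "k \<in> borel_measurable borel" "l \<in> borel_measurable borel" "u \<in> borel_measurable M"
    using k l u by auto
  define K where "K = (\<integral>\<^sup>+w. norm (k w) \<partial>lborel)"
  define L where "L = (\<integral>\<^sup>+w. norm (l w) \<partial>lborel)"
  define U where "U = (\<integral>\<^sup>+s. norm (u s) \<partial>M)"
  define N where "N x p = ennreal (norm (case p of (s, t) \<Rightarrow> k (\<psi> x - \<psi> t) * (l (\<psi> t - \<psi> s) * u s)))" for x p
  have [measurable]: "case_prod N \<in> borel_measurable (M \<Otimes>\<^sub>M (M \<Otimes>\<^sub>M M))"
    unfolding N_def by measurable
  have pair3: "pair_sigma_finite M (M \<Otimes>\<^sub>M M)"
  proof -
    interpret pair_sigma_finite M M ..
    show ?thesis ..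
  qed
  have meas: "(\<lambda>x. \<integral>\<^sup>+p. N x p \<partial>(M \<Otimes>\<^sub>M M)) \<in> borel_measurable M"
  proof -
    have "sigma_finite_measure (M \<Otimes>\<^sub>M M)"
      using pair3 by (simp add: pair_sigma_finite_def)
    then show ?thesis
      by (rule sigma_finite_measure.borel_measurable_nn_integral) measurable
  qed
  \<comment> \<open>Integrating over \<open>x\<close> first leaves \<open>k\<close> as the only
    factor involved, and its integral is at most \<open>K\<close> whatever \<open>t\<close>
    is.\<close>
  have "(\<integral>\<^sup>+x. (\<integral>\<^sup>+p. N x p \<partial>(M \<Otimes>\<^sub>M M)) \<partial>M) = (\<integral>\<^sup>+p. (\<integral>\<^sup>+x. N x p \<partial>M) \<partial>(M \<Otimes>\<^sub>M M))"
    by (rule pair_sigma_finite.Fubini'[OF pair3, symmetric]) measurable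
  also have "\<dots> \<le> (\<integral>\<^sup>+p. K * (case p of (s, t) \<Rightarrow> ennreal (norm (l (\<psi> t - \<psi> s))) * norm (u s)) \<partial>(M \<Otimes>\<^sub>M M))"
  proof (intro nn_integral_mono)
    fix p :: "'a \<times> 'a"
    obtain s t where p: "p = (s, t)" by (cases p)
    have "(\<integral>\<^sup>+x. N x p \<partial>M) = (\<integral>\<^sup>+x. ennreal (norm (k (\<psi> x - \<psi> t))) * (ennreal (norm (l (\<psi> t - \<psi> s))) * norm (u s)) \<partial>M)"
      by (simp add: N_def p norm_mult ennreal_mult)
    also have "\<dots> = (\<integral>\<^sup>+x. ennreal (norm (k (\<psi> x - \<psi> t))) \<partial>M) * (ennreal (norm (l (\<psi> t - \<psi> s))) * norm (u s))"
      by (rule nn_integral_multc) measurable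
    also have "\<dots> \<le> K * (ennreal (norm (l (\<psi> t - \<psi> s))) * norm (u s))"
      unfolding K_def by (intro mult_right_mono nn_integral_shift_psi_le[where h = "\<lambda>w. ennreal (norm (k w))"]) auto
    finally show "(\<integral>\<^sup>+x. N x p \<partial>M) \<le> K * (case p of (s, t) \<Rightarrow> ennreal (norm (l (\<psi> t - \<psi> s))) * norm (u s))"
      by (simp add: p)
  qed
  also have "\<dots> = K * (\<integral>\<^sup>+p. (case p of (s, t) \<Rightarrow> ennreal (norm (l (\<psi> t - \<psi> s))) * norm (u s)) \<partial>(M \<Otimes>\<^sub>M M))"
    by (rule nn_integral_cmult) measurable
  \<comment> \<open>With \<open>s\<close> outside and \<open>t\<close> inside, the translation bound
    applies to \<open>l\<close> in the same way.\<close>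
  also have "(\<integral>\<^sup>+p. (case p of (s, t) \<Rightarrow> ennreal (norm (l (\<psi> t - \<psi> s))) * norm (u s)) \<partial>(M \<Otimes>\<^sub>M M))
      = (\<integral>\<^sup>+s. (\<integral>\<^sup>+t. ennreal (norm (l (\<psi> t - \<psi> s))) * norm (u s) \<partial>M) \<partial>M)"
    using nn_integral_fst[where f = "\<lambda>(s, t). ennreal (norm (l (\<psi> t - \<psi> s))) * norm (u s)" and ?M1.0 = M, symmetric] by simp
  also have "\<dots> = (\<integral>\<^sup>+s. (\<integral>\<^sup>+t. ennreal (norm (l (\<psi> t - \<psi> s))) \<partial>M) * norm (u s) \<partial>M)"
    by (intro nn_integral_cong nn_integral_multc) measurable
  also have "K * \<dots> \<le> K * (\<integral>\<^sup>+s. L * norm (u s) \<partial>M)"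
    unfolding L_def
    by (intro mult_left_mono nn_integral_mono mult_right_mono nn_integral_shift_psi_le[where h = "\<lambda>w. ennreal (norm (l w))"]) auto
  also have "\<dots> = K * (L * U)"
    unfolding U_def by (subst nn_integral_cmult) auto
  also have "\<dots> < \<infinity>"
    using k l u by (simp add: K_def L_def U_def integrable_iff_bounded ennreal_mult_less_top)
  finally have "AE x in M. (\<integral>\<^sup>+p. N x p \<partial>(M \<Otimes>\<^sub>M M)) \<noteq> \<infinity>"
    by (intro nn_integral_PInf_AE meas) auto
  then show ?thesis
    using AE_space
  proof eventually_elim
    fix x assume fin: "(\<integral>\<^sup>+p. N x p \<partial>(M \<Otimes>\<^sub>M M)) \<noteq> \<infinity>" and "x \<in> space M"
    show "integrable (M \<Otimes>\<^sub>M M) (\<lambda>(s, t). k (\<psi> x - \<psi> t) * (l (\<psi> t - \<psi> s) * u s))"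
      using fin by (intro integrableI_bounded) (measurable, simp add: N_def less_top)
  qed
qed

lemma volterra_volterra:
  fixes k l :: "real \<Rightarrow> complex"
  assumes "integrable (M \<Otimes>\<^sub>M M) (\<lambda>(s, t). k (\<psi> x - \<psi> t) * (l (\<psi> t - \<psi> s) * u s))"
  shows "volterra k (volterra l u) x = (\<integral>s. (\<integral>t. k (\<psi> x - \<psi> t) * l (\<psi> t - \<psi> s) \<partial>M) * u s \<partial>M)"
proof -
  interpret pair_sigma_finite M M ..
  have "volterra k (volterra l u) x = (\<integral>t. (\<integral>s. k (\<psi> x - \<psi> t) * (l (\<psi> t - \<psi> s) * u s) \<partial>M) \<partial>M)"
    unfolding volterra_def by simp
  also have "\<dots> = (\<integral>s. (\<integral>t. k (\<psi> x - \<psi> t) * (l (\<psi> t - \<psi> s) * u s) \<partial>M) \<partial>M)"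
    by (rule Fubini_integral) (use assms in simp)
  also have "\<dots> = (\<integral>s. (\<integral>t. k (\<psi> x - \<psi> t) * l (\<psi> t - \<psi> s) \<partial>M) * u s \<partial>M)"
    by (simp flip: mult.assoc)
  finally show ?thesis .
qed

text \<open>Fubini is applied to each side separately, so the exceptional null sets of both orders
  of composition are discarded.\<close>

lemma AE_volterra_commute:
  fixes k l :: "real \<Rightarrow> complex"
  assumes k: "integrable lborel k" "\<And>s. s \<le> 0 \<Longrightarrow> k s = 0"
    and l: "integrable lborel l" "\<And>s. s \<le> 0 \<Longrightarrow> l s = 0"
    and u: "integrable M u"
  shows "AE x in M. volterra k (volterra l u) x = volterra l (volterra k u) x"
  using AE_integrable_iterated_kernel[OF k(1) l(1) u] AE_integrable_iterated_kernel[OF l(1) k(1) u] AE_space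
proof eventually_elim
  fix x assume x: "x \<in> space M"
    and "integrable (M \<Otimes>\<^sub>M M) (\<lambda>(s, t). k (\<psi> x - \<psi> t) * (l (\<psi> t - \<psi> s) * u s))"
    and "integrable (M \<Otimes>\<^sub>M M) (\<lambda>(s, t). l (\<psi> x - \<psi> t) * (k (\<psi> t - \<psi> s) * u s))"
  moreover have "k \<in> borel_measurable borel" "l \<in> borel_measurable borel" using k l by auto
  ultimately show "volterra k (volterra l u) x = volterra l (volterra k u) x"
    using k l by (auto simp: volterra_volterra convolution_commute intro!: Bochner_Integration.integral_cong)
qed

end

section \<open>Change of variables for a monotone C^1 function\<close>

text \<open>The derivatives at \<open>a\<close> and \<open>b\<close> are one-sided, while the
  substitution rule used below wants two-sided ones. Integrating a continuous extension of
  \<open>\<psi>'\<close> repairs this without changing \<open>\<psi>\<close> on the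
  interval.\<close>

lemma C1_extension:
  fixes \<psi> \<psi>' :: "real \<Rightarrow> real"
  assumes "a \<le> b"
    and deriv: "\<And>x. x \<in> {a..b} \<Longrightarrow> (\<psi> has_real_derivative \<psi>' x) (at x within {a..b})"
    and cont: "continuous_on {a..b} \<psi>'"
  obtains g where "\<And>x. x \<in> {a..b} \<Longrightarrow> g x = \<psi> x"
    and "\<And>x. x \<in> {a..b} \<Longrightarrow> (g has_real_derivative \<psi>' x) (at x)"
proof -
  \<comment> \<open>Clamping the argument to \<open>{a..b}\<close> extends \<open>\<psi>'\<close> by
    its end values to a continuous function on the line.\<close>
  define h where "h x = \<psi>' (max a (min b x))" for x
  have h: "continuous_on S h" for S
    unfolding h_def
    by (rule continuous_on_compose2[OF cont]) (use \<open>a \<le> b\<close> in \<open>auto intro!: continuous_intros\<close>)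
  have h_eq: "h x = \<psi>' x" if "x \<in> {a..b}" for x
    using that by (simp add: h_def)
  \<comment> \<open>Starting the integral at \<open>a-1\<close> makes \<open>a\<close> an interior
    point of the domain of differentiation; the constants give
    \<open>g a = \<psi> a\<close>.\<close>
  define g where "g x = integral {a-1..x} h - integral {a-1..a} h + \<psi> a" for x
  show thesis
  proof
    fix x assume x: "x \<in> {a..b}"
    have "(\<psi>' has_integral \<psi> x - \<psi> a) {a..x}"
      using x by (intro fundamental_theorem_of_calculus)
        (auto simp flip: has_real_derivative_iff_has_vector_derivative intro!: DERIV_subset[OF deriv])
    then have "(h has_integral \<psi> x - \<psi> a) {a..x}"
      by (rule has_integral_eq[rotated]) (use x h_eq in auto)
    moreover have "integral {a-1..a} h + integral {a..x} h = integral {a-1..x} h"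
      by (rule Henstock_Kurzweil_Integration.integral_combine)
        (use x in \<open>auto intro!: integrable_continuous_interval h\<close>)
    ultimately show "g x = \<psi> x"
      unfolding g_def by (auto dest!: integral_unique)
    have "((\<lambda>x. integral {a-1..x} h) has_real_derivative h x) (at x within {a-1..b+1})"
      using x by (intro integral_has_real_derivative h) auto
    then have "((\<lambda>x. integral {a-1..x} h) has_real_derivative h x) (at x)"
      using x by (subst (asm) at_within_interior) auto
    then show "(g has_real_derivative \<psi>' x) (at x)"
      unfolding g_def using h_eq[OF x] by (auto intro!: derivative_eq_intros)
  qed
qed

lemma distr_phi_measure:
  fixes \<psi> \<psi>' :: "real \<Rightarrow> real"
  assumes "a < b"
    and deriv: "\<And>x. x \<in> {a..b} \<Longrightarrow> (\<psi> has_real_derivative \<psi>' x) (at x within {a..b})"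
    and cont: "continuous_on {a..b} \<psi>'"
    and nonneg: "\<And>x. x \<in> {a..b} \<Longrightarrow> 0 \<le> \<psi>' x"
  shows "distr (phi_measure a b \<psi>') borel \<psi> = density lborel (indicator {\<psi> a..\<psi> b})"
proof (rule measure_eqI)
  have "continuous_on {a..b} \<psi>"
    using deriv by (rule DERIV_continuous_on)
  then have [measurable]: "\<psi> \<in> borel_measurable (lebesgue_on {a..b})" "\<psi>' \<in> borel_measurable (lebesgue_on {a..b})"
    using cont by (auto intro: continuous_imp_measurable_on_sets_lebesgue)
  obtain g where g: "\<And>x. x \<in> {a..b} \<Longrightarrow> g x = \<psi> x"
    "\<And>x. x \<in> {a..b} \<Longrightarrow> (g has_real_derivative \<psi>' x) (at x)"
    using C1_extension[of a b \<psi> \<psi>'] assms by auto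
  fix B assume "B \<in> sets (distr (phi_measure a b \<psi>') borel \<psi>)"
  then have [measurable]: "B \<in> sets borel" by simp
  have vimage: "\<psi> -` B \<inter> space (lebesgue_on {a..b}) \<in> sets (lebesgue_on {a..b})"
    by (rule measurable_sets) measurable
  have "emeasure (distr (phi_measure a b \<psi>') borel \<psi>) B
      = emeasure (phi_measure a b \<psi>') (\<psi> -` B \<inter> space (lebesgue_on {a..b}))"
    by (subst emeasure_distr) (auto simp: phi_measure_def)
  also have "\<dots> = (\<integral>\<^sup>+x. ennreal \<bar>\<psi>' x\<bar> * indicator (\<psi> -` B \<inter> space (lebesgue_on {a..b})) x \<partial>lebesgue_on {a..b})"
    unfolding phi_measure_def using vimage by (subst emeasure_density) auto
  \<comment> \<open>The restricted Lebesgue integral becomes one over \<open>lborel\<close> with the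
    indicator of \<open>{a..b}\<close>, on which \<open>g\<close> agrees with
    \<open>\<psi>\<close>.\<close>
  also have "\<dots> = (\<integral>\<^sup>+x. indicator B (g x) * ennreal (\<psi>' x) * indicator {a..b} x \<partial>lborel)"
    by (subst nn_integral_restrict_space)
      (auto simp: nn_integral_completion g nonneg indicator_def intro!: nn_integral_cong)
  also have "\<dots> = (\<integral>\<^sup>+x. indicator B x * indicator {g a..g b} x \<partial>lborel)"
    by (rule nn_integral_substitution_aux[symmetric]) (use assms g in auto)
  also have "\<dots> = emeasure (density lborel (indicator {\<psi> a..\<psi> b})) B"
    using \<open>a < b\<close> by (subst emeasure_density) (auto simp: g mult.commute)
  finally show "emeasure (distr (phi_measure a b \<psi>') borel \<psi>) B = emeasure (density lborel (indicator {\<psi> a..\<psi> b})) B" .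
qed simp

lemma mono_on_has_real_derivative_nonneg:
  fixes f :: "real \<Rightarrow> real"
  assumes "a < b" "mono_on {a..b} f" "x \<in> {a..b}" "(f has_real_derivative D) (at x within {a..b})"
  shows "0 \<le> D"
proof (rule tendsto_lowerbound)
  show "((\<lambda>y. (f y - f x) / (y - x)) \<longlongrightarrow> D) (at x within {a..b})"
    using assms(4) by (simp add: has_field_derivative_iff)
  have "0 \<le> (f y - f x) / (y - x)" if "y \<in> {a..b}" for y
    using mono_onD[OF assms(2) assms(3) that] mono_onD[OF assms(2) that assms(3)]
    by (cases "x \<le> y") (auto intro: divide_nonneg_nonneg divide_nonpos_nonpos)
  then show "\<forall>\<^sub>F y in at x within {a..b}. 0 \<le> (f y - f x) / (y - x)"
    by (auto simp: eventually_at_filter)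
  show "at x within {a..b} \<noteq> bot"
    using assms(1,3) by (simp add: trivial_limit_within islimpt_Icc)
qed

lemma uniformizing_map_phi_measure:
  fixes \<psi> \<psi>' :: "real \<Rightarrow> real"
  assumes "a < b"
    and deriv: "\<And>x. x \<in> {a..b} \<Longrightarrow> (\<psi> has_real_derivative \<psi>' x) (at x within {a..b})"
    and cont: "continuous_on {a..b} \<psi>'"
    and mono: "mono_on {a..b} \<psi>"
  shows "uniformizing_map (phi_measure a b \<psi>') \<psi> (\<psi> a) (\<psi> b)"
proof -
  have nonneg: "0 \<le> \<psi>' x" if "x \<in> {a..b}" for x
    using mono_on_has_real_derivative_nonneg[OF \<open>a < b\<close> mono that deriv[OF that]] .
  have "continuous_on {a..b} \<psi>"
    using deriv by (rule DERIV_continuous_on)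
  then have meas: "\<psi> \<in> borel_measurable (phi_measure a b \<psi>')"
    by (auto simp: phi_measure_def intro: continuous_imp_measurable_on_sets_lebesgue)
  have distr: "distr (phi_measure a b \<psi>') borel \<psi> = density lborel (indicator {\<psi> a..\<psi> b})"
    using \<open>a < b\<close> deriv cont nonneg by (rule distr_phi_measure)
  \<comment> \<open>Finiteness is read off from the image measure: the total mass is the length of
    \<open>{\<psi> a..\<psi> b}\<close>.\<close>
  have "emeasure (phi_measure a b \<psi>') (space (phi_measure a b \<psi>')) = emeasure (distr (phi_measure a b \<psi>') borel \<psi>) UNIV"
    by (subst emeasure_distr) (use meas in auto)
  also have "\<dots> = emeasure lborel {\<psi> a..\<psi> b}"
    by (simp add: distr emeasure_density)
  finally have "finite_measure (phi_measure a b \<psi>')"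
    by (intro finite_measureI) (simp add: emeasure_lborel_Icc_eq)
  moreover have "\<psi> x \<in> {\<psi> a..\<psi> b}" if "x \<in> space (phi_measure a b \<psi>')" for x
    using that \<open>a < b\<close> mono_onD[OF mono, of a x] mono_onD[OF mono, of x b] by (simp add: phi_measure_def)
  ultimately show ?thesis
    using meas distr unfolding uniformizing_map_def uniformizing_map_axioms_def by blast
qed

section \<open>Integrability of the kernels\<close>

text \<open>Principal powers are multiplicative as soon as one factor is a nonnegative real. For
  \<open>\<sigma> = -1\<close> this reduces powers of negative reals to those of positive ones, up
  to a factor independent of \<open>s\<close>.\<close>

lemma of_real_mult_powr:
  "0 \<le> s \<Longrightarrow> complex_of_real (\<sigma> * s) powr w = of_real s powr w * of_real \<sigma> powr w"
  using powr_times_real_left[of "of_real s" "of_real \<sigma>" w] by (simp add: mult.commute)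

lemma norm_of_real_mult_powr:
  "0 \<le> s \<Longrightarrow> norm (complex_of_real (\<sigma> * s) powr w) = s powr Re w * norm (complex_of_real \<sigma> powr w)"
  unfolding of_real_mult_powr by (simp add: norm_mult norm_powr_real_powr)

text \<open>The argument of \<open>B\<close> stays in a closed disc inside \<open>ball 0 r\<close>,
  where \<open>B\<close> is bounded by compactness. What remains is a multiple of
  \<open>s powr (Re \<alpha> - 1)\<close>, integrable at 0 because
  \<open>Re \<alpha> > 0\<close>.\<close>

lemma integrable_power_kernel:
  fixes \<sigma> m r :: real and B :: "complex \<Rightarrow> complex"
  assumes \<alpha>: "0 < Re \<alpha>" and \<beta>: "0 < Re \<beta>" and m: "0 \<le> m"
    and B: "continuous_on (ball 0 r) B" and r: "norm (complex_of_real (\<sigma> * m) powr \<beta>) < r"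
  shows "integrable lborel (\<lambda>s. indicator {0<..m} s *\<^sub>R
    (complex_of_real (\<sigma> * s) powr (\<alpha> - 1) * B (complex_of_real (\<sigma> * s) powr \<beta>)))"
proof -
  \<comment> \<open>Since \<open>Re \<beta> > 0\<close>, the modulus of the power is nondecreasing
    in \<open>s\<close>, so its value at \<open>m\<close> bounds it on
    \<open>{0..m}\<close>.\<close>
  define r0 where "r0 = norm (complex_of_real (\<sigma> * m) powr \<beta>)"
  have le: "norm (complex_of_real (\<sigma> * s) powr \<beta>) \<le> r0" if "s \<in> {0..m}" for s
    unfolding r0_def using that \<beta> m
    by (subst (1 2) norm_of_real_mult_powr) (auto intro!: mult_right_mono powr_mono2)
  have "continuous_on (cball 0 r0) B"
    by (rule continuous_on_subset[OF B]) (use r in \<open>auto simp: r0_def\<close>)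
  then obtain C where C: "norm (B z) \<le> C" if "z \<in> cball 0 r0" for z
    using compact_continuous_image[of "cball 0 r0" B]
    by (metis bounded_iff compact_cball compact_imp_bounded imageI)
  \<comment> \<open>For negative \<open>\<sigma>\<close> the base runs along the branch cut;
    factoring out the power of \<open>\<sigma>\<close> keeps it on the positive axis.\<close>
  have cont: "continuous_on {0<..m} (\<lambda>s. complex_of_real (\<sigma> * s) powr w)" for w
  proof -
    have "continuous_on {0<..m} (\<lambda>s. complex_of_real s powr w * of_real \<sigma> powr w)"
      by (intro continuous_intros) (auto simp: complex_nonpos_Reals_iff)
    then show ?thesis
      by (rule continuous_on_cong[THEN iffD1, rotated 2]) (auto simp: of_real_mult_powr simp del: of_real_mult)
  qed
  have contK: "continuous_on {0<..m} (\<lambda>s. complex_of_real (\<sigma> * s) powr (\<alpha> - 1) * B (complex_of_real (\<sigma> * s) powr \<beta>))"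
  proof (intro continuous_on_mult cont continuous_on_compose2[OF B])
    show "(\<lambda>s. complex_of_real (\<sigma> * s) powr \<beta>) ` {0<..m} \<subseteq> ball 0 r"
      using le_less_trans[OF le] r by (auto simp: r0_def simp del: of_real_mult)
  qed
  define D where "D = norm (complex_of_real \<sigma> powr (\<alpha> - 1)) * C"
  have "(\<lambda>s. s powr (Re \<alpha> - 1)) absolutely_integrable_on {0..m}"
    using \<alpha> m by (intro nonnegative_absolutely_integrable_1 integrable_on_powr_from_0) auto
  then have "set_integrable lborel {0..m} (\<lambda>s. s powr (Re \<alpha> - 1))"
    unfolding set_integrable_def by (subst (asm) integrable_completion) auto
  then have "integrable lborel (\<lambda>s. D * (indicator {0..m} s * s powr (Re \<alpha> - 1)))"
    unfolding set_integrable_def by simp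
  then show ?thesis
  proof (rule Bochner_Integration.integrable_bound)
    show "(\<lambda>s. indicator {0<..m} s *\<^sub>R
      (complex_of_real (\<sigma> * s) powr (\<alpha> - 1) * B (complex_of_real (\<sigma> * s) powr \<beta>))) \<in> borel_measurable lborel"
      using borel_measurable_continuous_on_indicator[OF _ contK] by simp
    have "norm (complex_of_real (\<sigma> * s) powr (\<alpha> - 1) * B (complex_of_real (\<sigma> * s) powr \<beta>))
        \<le> \<bar>D * s powr (Re \<alpha> - 1)\<bar>" if "s \<in> {0<..m}" for s
    proof -
      have "norm (complex_of_real (\<sigma> * s) powr (\<alpha> - 1) * B (complex_of_real (\<sigma> * s) powr \<beta>))
        \<le> s powr (Re \<alpha> - 1) * norm (complex_of_real \<sigma> powr (\<alpha> - 1)) * C"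
        unfolding norm_mult using that le C
        by (subst norm_of_real_mult_powr) (auto intro!: mult_left_mono)
      then show ?thesis by (simp add: D_def mult_ac)
    qed
    then show "AE s in lborel. norm (indicator {0<..m} s *\<^sub>R
      (complex_of_real (\<sigma> * s) powr (\<alpha> - 1) * B (complex_of_real (\<sigma> * s) powr \<beta>)))
      \<le> norm (D * (indicator {0..m} s * s powr (Re \<alpha> - 1)))"
      by (auto simp: indicator_def)
  qed
qed

section \<open>Fractional integrals as Volterra operators\<close>

text \<open>In a composition, this permits rewriting the inner operator on \<open>{a..b}\<close>
  alone, where its Volterra form is known.\<close>

lemma frac_int_cong:
  assumes "\<And>t. t \<in> {a..x} \<Longrightarrow> u t = v t"
  shows "frac_int a \<phi> \<phi>' A \<alpha> \<beta> u x = frac_int a \<phi> \<phi>' A \<alpha> \<beta> v x"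
  unfolding frac_int_def by (rule set_lebesgue_integral_cong) (use assms in auto)

text \<open>The factor \<open>\<sigma>\<close> in front compensates for passing from \<open>\<phi>'\<close> to \<open>\<bar>\<phi>'\<bar> = \<sigma> \<phi>'\<close>.  Dropping \<open>s = 0\<close>
  loses nothing, since \<open>0 powr w = 0\<close>.\<close>

definition signed_kernel ::
  "(complex \<Rightarrow> complex \<Rightarrow> complex \<Rightarrow> complex) \<Rightarrow> real \<Rightarrow> real \<Rightarrow> complex \<Rightarrow> complex \<Rightarrow> real \<Rightarrow> complex" where
  "signed_kernel A \<sigma> m \<alpha> \<beta> s = of_real \<sigma> * (indicator {0<..m} s *\<^sub>R
    (complex_of_real (\<sigma> * s) powr (\<alpha> - 1) * A \<alpha> \<beta> (complex_of_real (\<sigma> * s) powr \<beta>)))"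

text \<open>The kernel vanishes when \<open>t\<close> lies to the right of \<open>x\<close>, which
  cuts the integral over \<open>{a..b}\<close> down to \<open>{a..x}\<close>. Its other cutoff, at
  the length of the range of \<open>\<sigma> * \<phi>\<close>, is never exceeded by a difference of
  values.\<close>

lemma frac_int_eq_volterra:
  fixes \<phi> \<phi>' :: "real \<Rightarrow> real" and \<sigma> :: real
  assumes "a < b" and \<sigma>: "\<bar>\<sigma>\<bar> = 1"
    and deriv: "\<And>x. x \<in> {a..b} \<Longrightarrow> (\<phi> has_real_derivative \<phi>' x) (at x within {a..b})"
    and cont: "continuous_on {a..b} \<phi>'"
    and mono: "mono_on {a..b} (\<lambda>x. \<sigma> * \<phi> x)"
    and k: "signed_kernel A \<sigma> (\<sigma> * \<phi> b - \<sigma> * \<phi> a) \<alpha> \<beta> \<in> borel_measurable borel"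
    and u: "u \<in> borel_measurable (lebesgue_on {a..b})"
    and x: "x \<in> {a..b}"
  shows "frac_int a \<phi> \<phi>' A \<alpha> \<beta> u x =
    uniformizing_map.volterra (phi_measure a b \<phi>') (\<lambda>x. \<sigma> * \<phi> x)
      (signed_kernel A \<sigma> (\<sigma> * \<phi> b - \<sigma> * \<phi> a) \<alpha> \<beta>) u x"
proof -
  define \<psi> where "\<psi> = (\<lambda>x. \<sigma> * \<phi> x)"
  define k where "k = signed_kernel A \<sigma> (\<psi> b - \<psi> a) \<alpha> \<beta>"
  have [measurable]: "k \<in> borel_measurable borel" using k by (simp add: k_def \<psi>_def)
  note [measurable] = u
  have deriv\<psi>: "(\<psi> has_real_derivative \<sigma> * \<phi>' t) (at t within {a..b})" if "t \<in> {a..b}" for t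
    unfolding \<psi>_def by (intro DERIV_cmult deriv that)
  have \<sigma>\<sigma>: "\<sigma> * \<sigma> = 1" using \<sigma> by (metis abs_mult_self_eq mult_1)
  have diff: "\<phi> y - \<phi> z = \<sigma> * (\<psi> y - \<psi> z)" for y z
    unfolding \<psi>_def by (simp add: \<sigma>\<sigma> flip: right_diff_distrib mult.assoc)
  have abs: "complex_of_real \<bar>\<phi>' t\<bar> * of_real \<sigma> = of_real (\<phi>' t)" if "t \<in> {a..b}" for t
  proof -
    have "0 \<le> \<sigma> * \<phi>' t"
      by (rule mono_on_has_real_derivative_nonneg[OF \<open>a < b\<close> _ that deriv\<psi>[OF that]]) (use mono in \<open>simp add: \<psi>_def\<close>)
    then have "\<bar>\<phi>' t\<bar> = \<sigma> * \<phi>' t"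
      using \<sigma> by (metis abs_mult abs_of_nonneg mult_1)
    then have "\<bar>\<phi>' t\<bar> * \<sigma> = \<phi>' t" using \<sigma>\<sigma> by simp
    then show ?thesis by (metis of_real_mult)
  qed
  have uni: "uniformizing_map (phi_measure a b (\<lambda>x. \<sigma> * \<phi>' x)) \<psi> (\<psi> a) (\<psi> b)"
    by (rule uniformizing_map_phi_measure[OF \<open>a < b\<close> deriv\<psi>])
      (use mono cont in \<open>auto simp: \<psi>_def intro!: continuous_intros\<close>)
  \<comment> \<open>The measure depends only on the modulus of the derivative, so the sign
    \<open>\<sigma>\<close> drops out.\<close>
  then interpret uniformizing_map "phi_measure a b \<phi>'" \<psi> "\<psi> a" "\<psi> b"
    using \<sigma> by (simp add: phi_measure_def abs_mult)
  have [measurable]: "\<psi> \<in> borel_measurable (lebesgue_on {a..b})"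
    using measurable_psi by (simp add: phi_measure_def)
  have [measurable]: "\<phi>' \<in> borel_measurable (lebesgue_on {a..b})"
    using cont by (auto intro: continuous_imp_measurable_on_sets_lebesgue)
  have "volterra k u x = (\<integral>t. k (\<psi> x - \<psi> t) * u t \<partial>phi_measure a b \<phi>')"
    by (rule volterra_def)
  also have "\<dots> = (\<integral>t. \<bar>\<phi>' t\<bar> *\<^sub>R (k (\<psi> x - \<psi> t) * u t) \<partial>lebesgue_on {a..b})"
    unfolding phi_measure_def by (subst integral_density) auto
  also have "\<dots> = (\<integral>t. indicator {a..b} t *\<^sub>R (\<bar>\<phi>' t\<bar> *\<^sub>R (k (\<psi> x - \<psi> t) * u t)) \<partial>lebesgue)"
    by (subst integral_restrict_space) auto
  also have "\<dots> = frac_int a \<phi> \<phi>' A \<alpha> \<beta> u x"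
    unfolding frac_int_def set_lebesgue_integral_def
  proof (rule Bochner_Integration.integral_cong[OF refl])
    fix t
    \<comment> \<open>The third case contains \<open>t = x\<close> and flat pieces of
      \<open>\<psi>\<close> to the left of \<open>x\<close>. There the kernel is cut off, and the
      original integrand vanishes too because \<open>0 powr (\<alpha> - 1) = 0\<close>.\<close>
    consider "t \<notin> {a..b}" | "t \<in> {a..x}" "\<psi> t < \<psi> x" | "t \<in> {a..x}" "\<psi> t = \<psi> x" | "t \<in> {x<..b}" "\<psi> x \<le> \<psi> t"
      using x mono_onD[OF mono, of t x] mono_onD[OF mono, of x t] unfolding \<psi>_def by fastforce
    then show "indicator {a..b} t *\<^sub>R (\<bar>\<phi>' t\<bar> *\<^sub>R (k (\<psi> x - \<psi> t) * u t)) =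
      indicator {a..x} t *\<^sub>R (complex_of_real (\<phi>' t) * complex_of_real (\<phi> x - \<phi> t) powr (\<alpha> - 1) *
        A \<alpha> \<beta> (complex_of_real (\<phi> x - \<phi> t) powr \<beta>) * u t)"
    proof cases
      case 1
      then show ?thesis using x by auto
    next
      case 2
      have t: "t \<in> {a..b}" using 2 x by auto
      have "\<psi> x \<le> \<psi> b" "\<psi> a \<le> \<psi> t"
        using mono_onD[OF mono, of x b] mono_onD[OF mono, of a t] t x by (auto simp: \<psi>_def)
      then have "k (\<psi> x - \<psi> t) = of_real \<sigma> * (complex_of_real (\<phi> x - \<phi> t) powr (\<alpha> - 1) *
        A \<alpha> \<beta> (complex_of_real (\<phi> x - \<phi> t) powr \<beta>))"
        using 2 unfolding k_def signed_kernel_def diff by simp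
      then show ?thesis
        using 2 t abs[OF t, symmetric] by (simp add: scaleR_conv_of_real mult_ac)
    next
      case 3
      then show ?thesis by (simp add: k_def signed_kernel_def diff)
    next
      case 4
      then show ?thesis by (simp add: k_def signed_kernel_def)
    qed
  qed
  finally show ?thesis by (simp add: k_def \<psi>_def)
qed

section \<open>Commutativity of the fractional integrals\<close>

theorem theorem3p6:
  fixes a b :: real
    and \<phi> \<phi>' :: "real \<Rightarrow> real"
    and A :: "complex \<Rightarrow> complex \<Rightarrow> complex \<Rightarrow> complex"
    and coeff :: "complex \<Rightarrow> complex \<Rightarrow> nat \<Rightarrow> complex"
    and R :: "complex \<Rightarrow> complex \<Rightarrow> real"
  assumes "a < b"
    and "\<And>x. x \<in> {a..b} \<Longrightarrow> (\<phi> has_real_derivative \<phi>' x) (at x within {a..b})"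
    and "continuous_on {a..b} \<phi>'"
    and "mono_on {a..b} \<phi> \<or> antimono_on {a..b} \<phi>"
    and "\<And>\<alpha> \<beta>. Re \<alpha> > 0 \<Longrightarrow> Re \<beta> > 0 \<Longrightarrow> R \<alpha> \<beta> > (b - a) powr Re \<beta>"
    and "\<And>\<alpha> \<beta>. Re \<alpha> > 0 \<Longrightarrow> Re \<beta> > 0 \<Longrightarrow> A \<alpha> \<beta> analytic_on ball 0 (R \<alpha> \<beta>)"
    and "\<And>\<alpha> \<beta> z. Re \<alpha> > 0 \<Longrightarrow> Re \<beta> > 0 \<Longrightarrow> z \<in> ball 0 (R \<alpha> \<beta>) \<Longrightarrow>
           (\<lambda>n. coeff \<alpha> \<beta> n * z ^ n) sums A \<alpha> \<beta> z"
    \<comment> \<open>the operators evaluate the kernels only inside their discs\<close>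
    and "\<And>\<alpha> \<beta> x t. Re \<alpha> > 0 \<Longrightarrow> Re \<beta> > 0 \<Longrightarrow> a \<le> t \<Longrightarrow> t \<le> x \<Longrightarrow> x \<le> b \<Longrightarrow>
           complex_of_real (\<phi> x - \<phi> t) powr \<beta> \<in> ball 0 (R \<alpha> \<beta>)"
  shows "\<forall>\<alpha> \<beta> \<gamma> \<delta>. Re \<alpha> > 0 \<longrightarrow> Re \<beta> > 0 \<longrightarrow> Re \<gamma> > 0 \<longrightarrow> Re \<delta> > 0 \<longrightarrow>
           (\<forall>u \<in> L1_phi a b \<phi>'. AE x in phi_measure a b \<phi>'.
              (frac_int a \<phi> \<phi>' A \<alpha> \<beta> \<circ> frac_int a \<phi> \<phi>' A \<gamma> \<delta>) u x =
              (frac_int a \<phi> \<phi>' A \<gamma> \<delta> \<circ> frac_int a \<phi> \<phi>' A \<alpha> \<beta>) u x)"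
proof (intro allI impI ballI)
  fix \<alpha> \<beta> \<gamma> \<delta> :: complex and u
  assume pos: "Re \<alpha> > 0" "Re \<beta> > 0" "Re \<gamma> > 0" "Re \<delta> > 0" and u: "u \<in> L1_phi a b \<phi>'"
  obtain \<sigma> :: real where \<sigma>: "\<bar>\<sigma>\<bar> = 1" and mono: "mono_on {a..b} (\<lambda>x. \<sigma> * \<phi> x)"
  proof (cases "mono_on {a..b} \<phi>")
    case True
    then show ?thesis using that[of 1] by simp
  next
    case False
    then have "mono_on {a..b} (\<lambda>x. -1 * \<phi> x)"
      using assms(4) by (auto simp: monotone_on_def)
    then show ?thesis using that[of "-1"] by simp
  qed
  define \<psi> where "\<psi> = (\<lambda>x. \<sigma> * \<phi> x)"
  define k where "k = signed_kernel A \<sigma> (\<psi> b - \<psi> a)"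
  let ?M = "phi_measure a b \<phi>'"
  have "uniformizing_map (phi_measure a b (\<lambda>x. \<sigma> * \<phi>' x)) \<psi> (\<psi> a) (\<psi> b)"
    unfolding \<psi>_def
    by (rule uniformizing_map_phi_measure[OF \<open>a < b\<close>])
      (use mono assms(2,3) in \<open>auto intro!: continuous_intros DERIV_cmult\<close>)
  then interpret uniformizing_map ?M \<psi> "\<psi> a" "\<psi> b"
    using \<sigma> by (simp add: phi_measure_def abs_mult)
  have k0: "k \<alpha> \<beta> s = 0" if "s \<le> 0" for \<alpha> \<beta> s
    using that by (simp add: k_def signed_kernel_def)
  have k_int: "integrable lborel (k \<alpha> \<beta>)" if "Re \<alpha> > 0" "Re \<beta> > 0" for \<alpha> \<beta>
  proof -
    \<comment> \<open>At \<open>s = \<psi> b - \<psi> a\<close> the kernel's power has base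
      \<open>\<phi> b - \<phi> a\<close>, so the disc hypothesis at \<open>x = b\<close>,
      \<open>t = a\<close> gives the required radius bound.\<close>
    have "\<sigma> * (\<psi> b - \<psi> a) = \<phi> b - \<phi> a"
      using \<sigma> by (auto simp: \<psi>_def abs_if split: if_splits)
    then have "norm (complex_of_real (\<sigma> * (\<psi> b - \<psi> a)) powr \<beta>) < R \<alpha> \<beta>"
      using assms(8)[OF that, of a b] \<open>a < b\<close> by simp
    moreover have "continuous_on (ball 0 (R \<alpha> \<beta>)) (A \<alpha> \<beta>)"
      using assms(6)[OF that] by (rule analytic_imp_holomorphic[THEN holomorphic_on_imp_continuous_on])
    moreover have "0 \<le> \<psi> b - \<psi> a"
      using mono_onD[OF mono, of a b] \<open>a < b\<close> by (simp add: \<psi>_def)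
    ultimately show ?thesis
      unfolding k_def signed_kernel_def
      using that by (intro integrable_mult_right impI integrable_power_kernel) auto
  qed
  have eq: "frac_int a \<phi> \<phi>' A \<alpha> \<beta> v x = volterra (k \<alpha> \<beta>) v x"
    if "Re \<alpha> > 0" "Re \<beta> > 0" "v \<in> borel_measurable (lebesgue_on {a..b})" "x \<in> {a..b}" for \<alpha> \<beta> v x
    using frac_int_eq_volterra[OF \<open>a < b\<close> \<sigma> assms(2,3) mono _ that(3,4), where A = A and \<alpha> = \<alpha> and \<beta> = \<beta>]
      borel_measurable_integrable[OF k_int[OF that(1,2)]]
    unfolding k_def \<psi>_def by simp
  have meas_u: "u \<in> borel_measurable (lebesgue_on {a..b})"
    using u by (simp add: L1_phi_def)
  have comp: "(frac_int a \<phi> \<phi>' A \<alpha> \<beta> \<circ> frac_int a \<phi> \<phi>' A \<gamma> \<delta>) u x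
      = volterra (k \<alpha> \<beta>) (volterra (k \<gamma> \<delta>) u) x"
    if "Re \<alpha> > 0" "Re \<beta> > 0" "Re \<gamma> > 0" "Re \<delta> > 0" "x \<in> {a..b}" for \<alpha> \<beta> \<gamma> \<delta> x
  proof -
    have "frac_int a \<phi> \<phi>' A \<alpha> \<beta> (frac_int a \<phi> \<phi>' A \<gamma> \<delta> u) x
        = frac_int a \<phi> \<phi>' A \<alpha> \<beta> (volterra (k \<gamma> \<delta>) u) x"
      by (rule frac_int_cong) (use that meas_u eq in auto)
    \<comment> \<open>Measurability of the inner result lets \<open>eq\<close> be applied to the
      outer operator.\<close>
    moreover have "volterra (k \<gamma> \<delta>) u \<in> borel_measurable ?M"
      using k_int[of \<gamma> \<delta>] that meas_u
      by (intro borel_measurable_volterra) (auto simp: phi_measure_def)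
    ultimately show ?thesis
      using that by (simp add: eq phi_measure_def)
  qed
  have [measurable]: "\<phi>' \<in> borel_measurable (lebesgue_on {a..b})"
    using assms(3) by (auto intro: continuous_imp_measurable_on_sets_lebesgue)
  \<comment> \<open>Both integrands have the same modulus, also where \<open>\<phi>'\<close> is
    negative.\<close>
  have "integrable (lebesgue_on {a..b}) (\<lambda>x. \<bar>\<phi>' x\<bar> *\<^sub>R u x)"
  proof (rule Bochner_Integration.integrable_bound)
    show "integrable (lebesgue_on {a..b}) (\<lambda>x. norm (u x) * \<phi>' x)"
      using u by (simp add: L1_phi_def)
  qed (use meas_u in \<open>auto simp: abs_mult\<close>)
  then have "integrable ?M u"
    unfolding phi_measure_def using meas_u by (subst integrable_density) auto
  then have "AE x in ?M. volterra (k \<alpha> \<beta>) (volterra (k \<gamma> \<delta>) u) x = volterra (k \<gamma> \<delta>) (volterra (k \<alpha> \<beta>) u) x"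
    using pos by (intro AE_volterra_commute k_int k0)
  then show "AE x in ?M. (frac_int a \<phi> \<phi>' A \<alpha> \<beta> \<circ> frac_int a \<phi> \<phi>' A \<gamma> \<delta>) u x =
      (frac_int a \<phi> \<phi>' A \<gamma> \<delta> \<circ> frac_int a \<phi> \<phi>' A \<alpha> \<beta>) u x"
    using AE_space
    by eventually_elim (use pos in \<open>simp add: comp phi_measure_def del: o_apply\<close>)
qed

end
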